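(* Let the finite group $G$ be the semidirect product of the (normal) subgroup $K$ by the abelian subgroup $H$. Let $\theta$ be a fixed-point-free endomorphism of $H$, and let $\eta$ be a nilpotent endomorphism of $K$. Define a map $\varphi$ on $G$ by $$(hk)^{\varphi} = h^{\theta}k^{\eta}, \qquad h\in H,\ k\in K.$$ Then the following are equivalent: (1) $\varphi$ is a quasi-invertible fixed-point-free endomorphism of $G$; (2) $G' = K'[K,H] \le \ker(\eta)$, and $[K^{\eta},H^{\theta}] = 1$.
   Context: Groups are written multiplicatively and maps are written as exponents. That $G$ is the semidirect product of $K$ by $H$ means that $K$ is a normal subgroup of $G$, $H$ is a subgroup of $G$, $G = HK$ and $H\cap K = 1$. $G'$ and $K'$ denote derived subgroups; $[A,B]$ denotes the subgroup generated by the commutators $[a,b]$, $a \in A$, $b \in B$. (Since $H$ is abelian, the equality $G' = K'[K,H]$ holds automatically.) For a map $\alpha$ on a group $X$, $X^{\alpha}$ denotes its image. For maps $\alpha,\beta : G \to G$, the maps $\alpha+\beta$, $-\alpha$ and $\alpha-\beta = \alpha + (-\beta)$ are defined pointwise by $x^{\alpha+\beta} = x^{\alpha}x^{\beta}$, $x^{-\alpha} = (x^{\alpha})^{-1}$, and the product is composition, $x^{\alpha\beta} = (x^{\alpha})^{\beta}$. The symbol $1$, used as a map, denotes the identity map of $G$; thus $x^{1-\varphi} = x\,(x^{\varphi})^{-1}$. An endomorphism $\varphi$ of a group $X$ is fixed-point-free if the only $x\in X$ with $x^{\varphi}=x$ is $x=1$. An endomorphism $\eta$ of $K$ is nilpotent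 if some power $\eta^{n}$ (under composition, $n \ge 1$) is the trivial map $k\mapsto 1$. A fixed-point-free endomorphism $\varphi$ of a finite group $G$ is quasi-invertible if there is an endomorphism $\psi$ of $G$ such that the map $1-\psi$ is the inverse of the map $1-\varphi$ with respect to composition of maps on $G$. *)

theory Defs
  imports "HOL-Algebra.Algebra"
begin

definition semidirect_product_of ::
    "('a, 'b) monoid_scheme \<Rightarrow> 'a set \<Rightarrow> 'a set \<Rightarrow> bool" where
  "semidirect_product_of G K H \<longleftrightarrow>
     K \<lhd> G \<and> subgroup H G \<and> carrier G = H <#>\<^bsub>G\<^esub> K \<and> H \<inter> K = {\<one>\<^bsub>G\<^esub>}"

(* [A, B], with the library's convention [a, b] = a b a^-1 b^-1 (as in derived_set); for subgroups
   A and B the subgroup generated is the same under the convention a^-1 b^-1 a b. *)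
definition commutator_subgroup ::
    "('a, 'b) monoid_scheme \<Rightarrow> 'a set \<Rightarrow> 'a set \<Rightarrow> 'a set" where
  "commutator_subgroup G A B =
     generate G (\<Union>a\<in>A. \<Union>b\<in>B. {a \<otimes>\<^bsub>G\<^esub> b \<otimes>\<^bsub>G\<^esub> inv\<^bsub>G\<^esub> a \<otimes>\<^bsub>G\<^esub> inv\<^bsub>G\<^esub> b})"

(* Endomorphisms are elements of hom G G; only their values on carrier G matter. *)
definition fixed_point_free_endo :: "('a, 'b) monoid_scheme \<Rightarrow> ('a \<Rightarrow> 'a) \<Rightarrow> bool" where
  "fixed_point_free_endo G \<phi> \<longleftrightarrow>
     \<phi> \<in> hom G G \<and> (\<forall>x\<in>carrier G. \<phi> x = x \<longrightarrow> x = \<one>\<^bsub>G\<^esub>)"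

definition nilpotent_endo :: "('a, 'b) monoid_scheme \<Rightarrow> ('a \<Rightarrow> 'a) \<Rightarrow> bool" where
  "nilpotent_endo G \<eta> \<longleftrightarrow>
     \<eta> \<in> hom G G \<and> (\<exists>n::nat. n \<ge> 1 \<and> (\<forall>x\<in>carrier G. (\<eta> ^^ n) x = \<one>\<^bsub>G\<^esub>))"

definition map_diff ::
    "('a, 'b) monoid_scheme \<Rightarrow> ('a \<Rightarrow> 'a) \<Rightarrow> ('a \<Rightarrow> 'a) \<Rightarrow> 'a \<Rightarrow> 'a" where
  "map_diff G \<alpha> \<beta> = (\<lambda>x. \<alpha> x \<otimes>\<^bsub>G\<^esub> inv\<^bsub>G\<^esub> (\<beta> x))"

definition inverse_maps_on :: "'a set \<Rightarrow> ('a \<Rightarrow> 'a) \<Rightarrow> ('a \<Rightarrow> 'a) \<Rightarrow> bool" where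
  "inverse_maps_on S \<alpha> \<beta> \<longleftrightarrow>
     \<alpha> \<in> S \<rightarrow> S \<and> \<beta> \<in> S \<rightarrow> S \<and> (\<forall>x\<in>S. \<beta> (\<alpha> x) = x) \<and> (\<forall>x\<in>S. \<alpha> (\<beta> x) = x)"

definition quasi_invertible :: "('a, 'b) monoid_scheme \<Rightarrow> ('a \<Rightarrow> 'a) \<Rightarrow> bool" where
  "quasi_invertible G \<phi> \<longleftrightarrow>
     fixed_point_free_endo G \<phi> \<and>
     (\<exists>\<psi>\<in>hom G G. inverse_maps_on (carrier G) (map_diff G id \<phi>) (map_diff G id \<psi>))"

end

theory Submission
  imports Defs
begin

text \<open>
  Write \<open>1 - \<phi>\<close> for the map \<open>x \<mapsto> x \<phi>(x)\<^sup>-\<^sup>1\<close>. The key fact is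
  \<open>quasi_invertible_iff_abelian_image\<close>: a fixed-point-free endomorphism \<open>\<phi>\<close> of a finite group is
  quasi-invertible if and only if its image is abelian. Indeed \<open>1 - \<phi>\<close> is bijective, and if \<open>1 - \<psi>\<close>
  inverts it then \<open>\<psi>\<close> must send \<open>x \<phi>(x)\<^sup>-\<^sup>1\<close> to \<open>\<phi>(x)\<^sup>-\<^sup>1\<close>. Comparing the two sides of
  \<open>\<psi>(y v) = \<psi>(y) \<psi>(v)\<close> for \<open>y = x \<phi>(x)\<^sup>-\<^sup>1\<close> and \<open>v = z \<phi>(z)\<^sup>-\<^sup>1\<close> shows that this \<open>\<psi>\<close> is an endomorphism
  if and only if \<open>a \<phi>(a)\<^sup>-\<^sup>1\<close> centralises \<open>\<phi>(G)\<close> for all \<open>a \<in> \<phi>(G)\<close>; and these elements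
  \<open>a \<phi>(a)\<^sup>-\<^sup>1\<close> exhaust \<open>\<phi>(G)\<close>.

  An abelian image means \<open>G' \<le> ker \<phi>\<close> (\<open>derived_subset_kernel_iff\<close>). For the semidirect product,
  \<open>G' \<le> K\<close> because \<open>G/K\<close> is abelian, and \<open>\<phi>\<close> restricts to \<open>\<eta>\<close> on \<open>K\<close> and to \<open>\<theta>\<close> on \<open>H\<close>; so the condition
  becomes \<open>G' \<le> ker \<eta>\<close>, and it forces \<open>\<eta>(K)\<close> and \<open>\<theta>(H)\<close> to commute.

  It remains to see that the conditions on \<open>\<eta>\<close> and \<open>\<theta>\<close> make \<open>\<phi>\<close> a fixed-point-free endomorphism. As \<open>\<eta>\<close>
  kills \<open>[K, H]\<close>, it does not see conjugation by \<open>H\<close>, and with the commuting of \<open>\<eta>(K)\<close> and \<open>\<theta>(H)\<close> this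
  makes \<open>\<phi>\<close> multiplicative. If \<open>\<phi>\<close> fixes \<open>h k\<close>, then modulo \<open>K\<close> the map \<open>\<theta>\<close> fixes \<open>h\<close>, so \<open>h = 1\<close>; then
  \<open>\<eta>\<close> fixes \<open>k\<close>, and \<open>k = 1\<close> by nilpotency.

  The identity \<open>G' = K'[K, H]\<close> is \<open>derived_eq_derived_mult_commutator_subgroup\<close>.
\<close>

section \<open>The derived subgroup of a semidirect product\<close>

context group
begin

lemma inv_mult_cancel_left:
  assumes "x \<in> carrier G" "y \<in> carrier G"
  shows "inv x \<otimes> (x \<otimes> y) = y" "x \<otimes> (inv x \<otimes> y) = y"
  using assms by (simp_all flip: m_assoc)

lemmas word_simps = m_assoc inv_mult_group inv_mult_cancel_left

lemma commutator_eq_one_iff: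
  assumes "x \<in> carrier G" "y \<in> carrier G"
  shows "x \<otimes> y \<otimes> inv x \<otimes> inv y = \<one> \<longleftrightarrow> x \<otimes> y = y \<otimes> x"
proof -
  have "x \<otimes> y \<otimes> inv x \<otimes> inv y = (x \<otimes> y) \<otimes> inv (y \<otimes> x)"
    using assms by (simp add: word_simps)
  then show ?thesis
    using assms by (metis inv_closed inv_equality inv_inv m_closed r_inv)
qed

lemma commutator_mem_swap:
  assumes "subgroup N G" "x \<in> carrier G" "y \<in> carrier G"
    and "x \<otimes> y \<otimes> inv x \<otimes> inv y \<in> N"
  shows "y \<otimes> x \<otimes> inv y \<otimes> inv x \<in> N"
proof -
  have "y \<otimes> x \<otimes> inv y \<otimes> inv x = inv (x \<otimes> y \<otimes> inv x \<otimes> inv y)"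
    using assms(2,3) by (simp add: word_simps)
  then show ?thesis
    using subgroup.m_inv_closed[OF assms(1,4)] by simp
qed

text \<open>
  The elements that commute with \<open>z\<close> modulo \<open>N\<close> are closed under products, so that the vanishing of
  commutators modulo \<open>N\<close> can be checked on factors.
\<close>

lemma commutator_mult_mem:
  assumes "N \<lhd> G" "x \<in> carrier G" "y \<in> carrier G" "z \<in> carrier G"
    and "x \<otimes> z \<otimes> inv x \<otimes> inv z \<in> N" "y \<otimes> z \<otimes> inv y \<otimes> inv z \<in> N"
  shows "(x \<otimes> y) \<otimes> z \<otimes> inv (x \<otimes> y) \<otimes> inv z \<in> N"
proof -
  have "(x \<otimes> y) \<otimes> z \<otimes> inv (x \<otimes> y) \<otimes> inv z
      = (x \<otimes> (y \<otimes> z \<otimes> inv y \<otimes> inv z) \<otimes> inv x) \<otimes> (x \<otimes> z \<otimes> inv x \<otimes> inv z)"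
    using assms(2-4) by (simp add: word_simps)
  then show ?thesis
    using normal_invE[OF assms(1)] assms(2,5,6) by (simp add: subgroup.m_closed)
qed

lemma set_mult_normal:
  assumes "M \<lhd> G" "N \<lhd> G"
  shows "M <#> N \<lhd> G"
proof (rule normal_invI)
  note M = normal_invE[OF assms(1)] and N = normal_invE[OF assms(2)]
  show "subgroup (M <#> N) G"
    by (rule mult_norm_subgroup[OF assms(1) N(1)])
  fix x g assume x: "x \<in> carrier G" and "g \<in> M <#> N"
  then obtain m n where mn: "m \<in> M" "n \<in> N" "g = m \<otimes> n"
    unfolding set_mult_def by blast
  then have "m \<in> carrier G" "n \<in> carrier G"
    using subgroup.mem_carrier[OF M(1)] subgroup.mem_carrier[OF N(1)] by simp_all
  then have "x \<otimes> g \<otimes> inv x = (x \<otimes> m \<otimes> inv x) \<otimes> (x \<otimes> n \<otimes> inv x)"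
    using x mn(3) by (simp add: word_simps)
  then show "x \<otimes> g \<otimes> inv x \<in> M <#> N"
    using M(2)[OF x mn(1)] N(2)[OF x mn(2)] unfolding set_mult_def by blast
qed

lemma commutator_mem_commutator_subgroup:
  "\<lbrakk>a \<in> A; b \<in> B\<rbrakk> \<Longrightarrow> a \<otimes> b \<otimes> inv a \<otimes> inv b \<in> commutator_subgroup G A B"
  unfolding commutator_subgroup_def by (rule generate.incl) blast

lemma commutator_subgroup_is_subgroup:
  assumes "A \<subseteq> carrier G" "B \<subseteq> carrier G"
  shows "subgroup (commutator_subgroup G A B) G"
  unfolding commutator_subgroup_def using assms
  by (intro generate_is_subgroup) (auto simp: subset_iff)

lemma commutator_subgroup_minimal:
  assumes "subgroup N G" "\<And>a b. \<lbrakk>a \<in> A; b \<in> B\<rbrakk> \<Longrightarrow> a \<otimes> b \<otimes> inv a \<otimes> inv b \<in> N"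
  shows "commutator_subgroup G A B \<subseteq> N"
  unfolding commutator_subgroup_def using assms
  by (intro generate_subgroup_incl) auto

lemma commutator_subgroup_trivial_iff:
  assumes "A \<subseteq> carrier G" "B \<subseteq> carrier G"
  shows "commutator_subgroup G A B = {\<one>} \<longleftrightarrow> (\<forall>a\<in>A. \<forall>b\<in>B. a \<otimes> b = b \<otimes> a)"
proof
  assume trivial: "commutator_subgroup G A B = {\<one>}"
  show "\<forall>a\<in>A. \<forall>b\<in>B. a \<otimes> b = b \<otimes> a"
  proof (intro ballI)
    fix a b assume ab: "a \<in> A" "b \<in> B"
    then have "a \<otimes> b \<otimes> inv a \<otimes> inv b = \<one>"
      using commutator_mem_commutator_subgroup[OF ab] trivial by simp
    moreover have "a \<in> carrier G" "b \<in> carrier G" using ab assms by auto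
    ultimately show "a \<otimes> b = b \<otimes> a" by (simp only: commutator_eq_one_iff)
  qed
next
  assume "\<forall>a\<in>A. \<forall>b\<in>B. a \<otimes> b = b \<otimes> a"
  then have "a \<otimes> b \<otimes> inv a \<otimes> inv b \<in> {\<one>}" if "a \<in> A" "b \<in> B" for a b
    using that assms by (subst singleton_iff, subst commutator_eq_one_iff) auto
  then have "commutator_subgroup G A B \<subseteq> {\<one>}"
    by (rule commutator_subgroup_minimal[OF triv_subgroup])
  then show "commutator_subgroup G A B = {\<one>}"
    using commutator_subgroup_is_subgroup[OF assms] subgroup.one_closed by blast
qed

text \<open>
  Unlike in \<open>normal_generateI\<close>, the conjugate of a generator need not be a generator again. This
  generality matters for \<open>[K, H]\<close>, where conjugation by \<open>K\<close> need not preserve the set of commutators.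
\<close>

lemma conj_generate_mem:
  assumes "S \<subseteq> carrier G" "g \<in> carrier G"
    and "\<And>s. s \<in> S \<Longrightarrow> g \<otimes> s \<otimes> inv g \<in> generate G S"
    and "x \<in> generate G S"
  shows "g \<otimes> x \<otimes> inv g \<in> generate G S"
  using assms(4)
proof (induction rule: generate.induct)
  case one
  then show ?case using assms(2) by (simp add: generate.one)
next
  case (incl x)
  then show ?case by (rule assms(3))
next
  case (inv x)
  then have "x \<in> carrier G" using assms(1) by blast
  moreover have "inv (g \<otimes> x \<otimes> inv g) \<in> generate G S"
    using inv assms(3) generate_m_inv_closed[OF assms(1)] by blast
  ultimately show ?case using assms(2) by (simp add: word_simps)
next
  case (eng x y)
  have c: "x \<in> carrier G" "y \<in> carrier G"
    using eng generate_in_carrier[OF assms(1)] by auto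
  have "(g \<otimes> x \<otimes> inv g) \<otimes> (g \<otimes> y \<otimes> inv g) \<in> generate G S"
    by (rule generate.eng[OF eng.IH])
  then show ?case using c assms(2) by (simp add: word_simps)
qed

lemma commutator_subgroup_normal:
  assumes "K \<lhd> G" "subgroup H G" "carrier G = H <#> K"
  shows "commutator_subgroup G K H \<lhd> G"
proof (rule normal_invI)
  let ?C = "commutator_subgroup G K H"
  note K = normal_invE[OF assms(1)]
  have KG: "K \<subseteq> carrier G" and HG: "H \<subseteq> carrier G"
    using K(1) assms(2) subgroup.subset by blast+
  show sub: "subgroup ?C G"
    by (rule commutator_subgroup_is_subgroup[OF KG HG])
  have conj: "g \<otimes> x \<otimes> inv g \<in> ?C"
    if "g \<in> carrier G" "x \<in> ?C"
      and "\<And>k h. \<lbrakk>k \<in> K; h \<in> H\<rbrakk> \<Longrightarrow> g \<otimes> (k \<otimes> h \<otimes> inv k \<otimes> inv h) \<otimes> inv g \<in> ?C" for g x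
    unfolding commutator_subgroup_def
  proof (rule conj_generate_mem[OF _ that(1)])
    show "(\<Union>k\<in>K. \<Union>h\<in>H. {k \<otimes> h \<otimes> inv k \<otimes> inv h}) \<subseteq> carrier G"
      using KG HG by (auto simp: subset_iff)
  qed (use that in \<open>auto simp: commutator_subgroup_def\<close>)
  \<comment> \<open>Conjugation by an element of \<open>H\<close> permutes the generators, since it preserves \<open>K\<close> and \<open>H\<close>.\<close>
  have conjH: "g \<otimes> (k \<otimes> h \<otimes> inv k \<otimes> inv h) \<otimes> inv g \<in> ?C"
    if "g \<in> H" "k \<in> K" "h \<in> H" for g k h
  proof -
    have c: "g \<in> carrier G" "k \<in> carrier G" "h \<in> carrier G"
      using that KG HG by auto
    have "g \<otimes> k \<otimes> inv g \<in> K" "g \<otimes> h \<otimes> inv g \<in> H"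
      using K(2) that c assms(2) by (auto intro: subgroup.m_closed subgroup.m_inv_closed)
    from commutator_mem_commutator_subgroup[OF this] show ?thesis
      using c by (simp add: word_simps)
  qed
  \<comment> \<open>A conjugate under \<open>l \<in> K\<close> is a quotient of two generators: \<open>l [k, h] l\<^sup>-\<^sup>1 = [l k, h] [l, h]\<^sup>-\<^sup>1\<close>.\<close>
  have conjK: "l \<otimes> (k \<otimes> h \<otimes> inv k \<otimes> inv h) \<otimes> inv l \<in> ?C"
    if "l \<in> K" "k \<in> K" "h \<in> H" for l k h
  proof -
    have c: "l \<in> carrier G" "k \<in> carrier G" "h \<in> carrier G"
      using that KG HG by auto
    have "l \<otimes> (k \<otimes> h \<otimes> inv k \<otimes> inv h) \<otimes> inv l
        = ((l \<otimes> k) \<otimes> h \<otimes> inv (l \<otimes> k) \<otimes> inv h) \<otimes> inv (l \<otimes> h \<otimes> inv l \<otimes> inv h)"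
      using c by (simp add: word_simps)
    then show ?thesis
      using that K(1) sub commutator_mem_commutator_subgroup
      by (simp add: subgroup.m_closed subgroup.m_inv_closed)
  qed
  fix g x assume "g \<in> carrier G" and x: "x \<in> ?C"
  then obtain h l where hl: "h \<in> H" "l \<in> K" "g = h \<otimes> l"
    unfolding assms(3) set_mult_def by blast
  then have c: "h \<in> carrier G" "l \<in> carrier G" "x \<in> carrier G"
    using KG HG subgroup.mem_carrier[OF sub x] by auto
  have "l \<otimes> x \<otimes> inv l \<in> ?C"
    by (rule conj[OF c(2) x conjK[OF hl(2)]])
  then have "h \<otimes> (l \<otimes> x \<otimes> inv l) \<otimes> inv h \<in> ?C"
    by (rule conj[OF c(1) _ conjH[OF hl(1)]])
  then show "g \<otimes> x \<otimes> inv g \<in> ?C"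
    using c hl(3) by (simp add: word_simps)
qed

text \<open>
  Both factors on the right are normal, so it suffices that every commutator vanishes modulo their
  product. There the factors \<open>H\<close> and \<open>K\<close> are abelian and commute with each other, and they generate.
\<close>

lemma derived_eq_derived_mult_commutator_subgroup:
  assumes "K \<lhd> G" "subgroup H G" "carrier G = H <#> K"
    and H_comm: "\<And>h h'. \<lbrakk>h \<in> H; h' \<in> H\<rbrakk> \<Longrightarrow> h \<otimes> h' = h' \<otimes> h"
  shows "derived G (carrier G) = derived G K <#> commutator_subgroup G K H"
proof
  let ?N = "derived G K <#> commutator_subgroup G K H"
  have KG: "K \<subseteq> carrier G" and HG: "H \<subseteq> carrier G"
    using assms(1,2) normal_imp_subgroup subgroup.subset by blast+
  note D = derived_is_subgroup[OF subset_refl]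
  have subC: "subgroup (commutator_subgroup G K H) G"
    by (rule commutator_subgroup_is_subgroup[OF KG HG])
  have subK: "subgroup (derived G K) G"
    by (rule derived_is_subgroup[OF KG])
  have "commutator_subgroup G K H \<subseteq> derived G (carrier G)"
    using KG HG D
    by (intro commutator_subgroup_minimal) (auto simp: derived_def intro!: generate.incl)
  then show "?N \<subseteq> derived G (carrier G)"
    using mono_derived[OF KG] subgroup.m_closed[OF D] unfolding set_mult_def by blast
  have N: "?N \<lhd> G"
    using assms(1-3) by (intro set_mult_normal derived_is_normal commutator_subgroup_normal)
  note subN = normal_imp_subgroup[OF N]
  have derK: "derived G K \<subseteq> ?N"
  proof
    fix x assume x: "x \<in> derived G K"
    then have "x = x \<otimes> \<one>" using subgroup.mem_carrier[OF subK] by simp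
    with x show "x \<in> ?N"
      using subgroup.one_closed[OF subC] unfolding set_mult_def by blast
  qed
  have comKH: "commutator_subgroup G K H \<subseteq> ?N"
  proof
    fix x assume x: "x \<in> commutator_subgroup G K H"
    then have "x = \<one> \<otimes> x" using subgroup.mem_carrier[OF subC] by simp
    with x show "x \<in> ?N"
      using subgroup.one_closed[OF subK] unfolding set_mult_def by blast
  qed
  have KK: "k \<otimes> k' \<otimes> inv k \<otimes> inv k' \<in> ?N" if "k \<in> K" "k' \<in> K" for k k'
  proof -
    have "k \<otimes> k' \<otimes> inv k \<otimes> inv k' \<in> derived G K"
      unfolding derived_def using that by (intro generate.incl) blast
    then show ?thesis using derK by blast
  qed
  have KH: "k \<otimes> h \<otimes> inv k \<otimes> inv h \<in> ?N" if "k \<in> K" "h \<in> H" for k h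
    using commutator_mem_commutator_subgroup[OF that] comKH by blast
  have HK: "h \<otimes> k \<otimes> inv h \<otimes> inv k \<in> ?N" if "k \<in> K" "h \<in> H" for k h
    by (rule commutator_mem_swap[OF subN _ _ KH[OF that]]) (use that KG HG in blast)+
  have HH: "h \<otimes> h' \<otimes> inv h \<otimes> inv h' \<in> ?N" if "h \<in> H" "h' \<in> H" for h h'
  proof -
    have "h \<otimes> h' \<otimes> inv h \<otimes> inv h' = \<one>"
      using that H_comm HG by (subst commutator_eq_one_iff) auto
    then show ?thesis using subgroup.one_closed[OF subN] by simp
  qed
  \<comment> \<open>Factoring first the left entry and then the right one reduces to these four cases.\<close>
  have left: "x \<otimes> z \<otimes> inv x \<otimes> inv z \<in> ?N" if "x \<in> carrier G" "z \<in> H \<union> K" for x z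
  proof -
    obtain h k where x: "h \<in> H" "k \<in> K" "x = h \<otimes> k"
      using \<open>x \<in> carrier G\<close> unfolding assms(3) set_mult_def by blast
    show ?thesis
      unfolding x(3) using x that(2) KG HG HH HK KH KK
      by (intro commutator_mult_mem[OF N]) auto
  qed
  have "x \<otimes> y \<otimes> inv x \<otimes> inv y \<in> ?N" if "x \<in> carrier G" "y \<in> carrier G" for x y
  proof -
    obtain h k where y: "h \<in> H" "k \<in> K" "y = h \<otimes> k"
      using \<open>y \<in> carrier G\<close> unfolding assms(3) set_mult_def by blast
    have c: "h \<in> carrier G" "k \<in> carrier G" using y KG HG by auto
    have "h \<otimes> x \<otimes> inv h \<otimes> inv x \<in> ?N"
      using y(1) by (intro commutator_mem_swap[OF subN that(1) c(1)] left[OF that(1)] UnI1)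
    moreover have "k \<otimes> x \<otimes> inv k \<otimes> inv x \<in> ?N"
      using y(2) by (intro commutator_mem_swap[OF subN that(1) c(2)] left[OF that(1)] UnI2)
    ultimately have "y \<otimes> x \<otimes> inv y \<otimes> inv x \<in> ?N"
      unfolding y(3) by (rule commutator_mult_mem[OF N c that(1)])
    then show ?thesis
      by (rule commutator_mem_swap[OF subN that(2,1)])
  qed
  then show "derived G (carrier G) \<subseteq> ?N"
    unfolding derived_def[of G "carrier G"]
    by (intro generate_subgroup_incl[OF _ subN] UN_least)
      (simp only: singleton_iff insert_subset empty_subsetI simp_thms)
qed

section \<open>Quasi-invertibility and abelian images\<close>

lemma derived_subset_kernel_iff:
  assumes "\<phi> \<in> hom G G"
  shows "derived G (carrier G) \<subseteq> kernel G G \<phi> \<longleftrightarrow>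
    (\<forall>x\<in>carrier G. \<forall>y\<in>carrier G. \<phi> x \<otimes> \<phi> y = \<phi> y \<otimes> \<phi> x)"
proof -
  interpret h: group_hom G G \<phi>
    using assms by unfold_locales
  have "derived G (carrier G) \<subseteq> kernel G G \<phi> \<longleftrightarrow> derived_set G (carrier G) \<subseteq> kernel G G \<phi>"
  proof
    assume "derived G (carrier G) \<subseteq> kernel G G \<phi>"
    moreover have "derived_set G (carrier G) \<subseteq> derived G (carrier G)"
      unfolding derived_def by (rule subsetI) (rule generate.incl)
    ultimately show "derived_set G (carrier G) \<subseteq> kernel G G \<phi>"
      by (rule subset_trans[rotated])
  next
    assume "derived_set G (carrier G) \<subseteq> kernel G G \<phi>"
    then show "derived G (carrier G) \<subseteq> kernel G G \<phi>"
      unfolding derived_def by (rule generate_subgroup_incl[OF _ h.subgroup_kernel])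
  qed
  also have "\<dots> \<longleftrightarrow> (\<forall>x\<in>carrier G. \<forall>y\<in>carrier G. \<phi> (x \<otimes> y \<otimes> inv x \<otimes> inv y) = \<one>)"
    unfolding UN_subset_iff kernel_def by (intro ball_cong refl) simp
  also have "\<dots> \<longleftrightarrow> (\<forall>x\<in>carrier G. \<forall>y\<in>carrier G. \<phi> x \<otimes> \<phi> y = \<phi> y \<otimes> \<phi> x)"
  proof (intro ball_cong refl)
    fix x y assume xy: "x \<in> carrier G" "y \<in> carrier G"
    then have "\<phi> (x \<otimes> y \<otimes> inv x \<otimes> inv y) = \<phi> x \<otimes> \<phi> y \<otimes> inv (\<phi> x) \<otimes> inv (\<phi> y)"
      by simp
    then show "\<phi> (x \<otimes> y \<otimes> inv x \<otimes> inv y) = \<one> \<longleftrightarrow> \<phi> x \<otimes> \<phi> y = \<phi> y \<otimes> \<phi> x"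
      by (simp only: commutator_eq_one_iff[OF h.hom_closed[OF xy(1)] h.hom_closed[OF xy(2)]])
  qed
  finally show ?thesis .
qed

text \<open>
  If \<open>x \<phi>(x)\<^sup>-\<^sup>1 = y \<phi>(y)\<^sup>-\<^sup>1\<close>, then \<open>y\<^sup>-\<^sup>1 x\<close> is fixed by \<open>\<phi>\<close>. Hence \<open>1 - \<phi>\<close> is injective, and finiteness
  makes it surjective on every \<open>\<phi>\<close>-invariant subgroup.
\<close>

lemma map_diff_fixed_point_free_bij:
  assumes "fixed_point_free_endo G \<phi>" "finite (carrier G)"
    and "subgroup S G" "\<phi> ` S \<subseteq> S"
  shows "bij_betw (map_diff G id \<phi>) S S"
proof -
  interpret h: group_hom G G \<phi>
    using assms(1) by unfold_locales (simp add: fixed_point_free_endo_def)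
  have SG: "S \<subseteq> carrier G" by (rule subgroup.subset[OF assms(3)])
  have "inj_on (map_diff G id \<phi>) S"
  proof (rule inj_onI)
    fix x y assume "x \<in> S" "y \<in> S" and eq: "map_diff G id \<phi> x = map_diff G id \<phi> y"
    then have c: "x \<in> carrier G" "y \<in> carrier G" using SG by auto
    have "\<phi> (inv y \<otimes> x) = inv y \<otimes> (y \<otimes> inv (\<phi> y)) \<otimes> \<phi> x"
      using c by (simp add: word_simps)
    also have "\<dots> = inv y \<otimes> (x \<otimes> inv (\<phi> x)) \<otimes> \<phi> x"
      using eq by (simp add: map_diff_def)
    also have "\<dots> = inv y \<otimes> x"
      using c by (simp add: word_simps)
    finally have "inv y \<otimes> x = \<one>"
      using assms(1) c by (simp add: fixed_point_free_endo_def)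
    then show "x = y"
      using c by (metis inv_closed inv_equality inv_inv)
  qed
  moreover have "map_diff G id \<phi> ` S \<subseteq> S"
    using assms(3,4)
    by (auto simp: map_diff_def intro!: subgroup.m_closed subgroup.m_inv_closed)
  moreover have "finite S" using assms(2) SG by (rule finite_subset[rotated])
  ultimately show ?thesis
    by (simp add: bij_betw_def endo_inj_surj)
qed

text \<open>
  The only map \<open>\<psi>\<close> for which \<open>1 - \<psi>\<close> can invert \<open>1 - \<phi>\<close> is \<open>x \<phi>(x)\<^sup>-\<^sup>1 \<mapsto> \<phi>(x)\<^sup>-\<^sup>1\<close>. It is multiplicative
  exactly if every \<open>a \<phi>(a)\<^sup>-\<^sup>1\<close> with \<open>a\<close> in the image of \<open>\<phi>\<close> commutes with that image. As \<open>1 - \<phi>\<close> maps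
  the image of \<open>\<phi>\<close> onto itself, this says that the image is abelian.
\<close>

lemma quasi_invertible_iff_abelian_image:
  assumes fpf: "fixed_point_free_endo G \<phi>" and fin: "finite (carrier G)"
  shows "quasi_invertible G \<phi> \<longleftrightarrow>
    (\<forall>x\<in>carrier G. \<forall>y\<in>carrier G. \<phi> x \<otimes> \<phi> y = \<phi> y \<otimes> \<phi> x)"
proof
  interpret h: group_hom G G \<phi>
    using fpf by unfold_locales (simp add: fixed_point_free_endo_def)
  let ?D = "map_diff G id \<phi>"
  assume "quasi_invertible G \<phi>"
  then obtain \<psi> where \<psi>: "\<psi> \<in> hom G G"
    and inv: "inverse_maps_on (carrier G) ?D (map_diff G id \<psi>)"
    unfolding quasi_invertible_def by blast
  interpret k: group_hom G G \<psi>
    using \<psi> by unfold_locales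
  have D_closed: "?D x \<in> carrier G" if "x \<in> carrier G" for x
    using that by (simp add: map_diff_def)
  have \<psi>_D: "\<psi> (?D x) = inv (\<phi> x)" if x: "x \<in> carrier G" for x
  proof -
    have "?D x \<otimes> inv (\<psi> (?D x)) = x"
      using inv x unfolding inverse_maps_on_def map_diff_def by simp
    then have "\<psi> (?D x) = inv x \<otimes> ?D x"
      using x D_closed[OF x] by (metis inv_solve_left inv_solve_right k.hom_closed inv_closed inv_inv)
    then show ?thesis using x by (simp add: map_diff_def word_simps)
  qed
  have central: "?D (\<phi> x) \<otimes> \<phi> z = \<phi> z \<otimes> ?D (\<phi> x)"
    if x: "x \<in> carrier G" and z: "z \<in> carrier G" for x z
  proof -
    \<comment> \<open>The preimage of \<open>?D x \<otimes> ?D z\<close> under \<open>1 - \<phi>\<close>, as computed by \<open>1 - \<psi>\<close>.\<close>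
    define w where "w = x \<otimes> inv (\<phi> x) \<otimes> z \<otimes> \<phi> x"
    have w: "w \<in> carrier G" using x z by (simp add: w_def)
    have "w = map_diff G id \<psi> (?D x \<otimes> ?D z)"
      using x z D_closed
      by (simp add: w_def map_diff_def[of G id \<psi>] \<psi>_D) (simp add: map_diff_def word_simps)
    then have "?D w = ?D x \<otimes> ?D z"
      using inv x z D_closed unfolding inverse_maps_on_def by simp
    then have "inv (\<phi> w) = inv (\<phi> x) \<otimes> inv (\<phi> z)"
      using \<psi>_D[OF w] \<psi>_D x z D_closed by simp
    then have "\<phi> w = \<phi> z \<otimes> \<phi> x"
      using w x z by (metis h.hom_closed inv_closed inv_inv inv_mult_group)
    then have "?D (\<phi> x) \<otimes> \<phi> z \<otimes> \<phi> (\<phi> x) = \<phi> z \<otimes> \<phi> x"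
      using x z by (simp add: w_def map_diff_def)
    then have "?D (\<phi> x) \<otimes> \<phi> z = \<phi> z \<otimes> \<phi> x \<otimes> inv (\<phi> (\<phi> x))"
      using x z D_closed by (metis h.hom_closed inv_solve_right m_closed)
    then show ?thesis using x z by (simp add: map_diff_def m_assoc)
  qed
  have "bij_betw ?D (\<phi> ` carrier G) (\<phi> ` carrier G)"
    by (rule map_diff_fixed_point_free_bij[OF fpf fin h.img_is_subgroup]) auto
  then have "?D ` (\<phi> ` carrier G) = \<phi> ` carrier G"
    by (simp add: bij_betw_def)
  then show "\<forall>x\<in>carrier G. \<forall>y\<in>carrier G. \<phi> x \<otimes> \<phi> y = \<phi> y \<otimes> \<phi> x"
    using central by (smt (verit) imageE imageI)
next
  interpret h: group_hom G G \<phi>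
    using fpf by unfold_locales (simp add: fixed_point_free_endo_def)
  let ?D = "map_diff G id \<phi>"
  assume comm: "\<forall>x\<in>carrier G. \<forall>y\<in>carrier G. \<phi> x \<otimes> \<phi> y = \<phi> y \<otimes> \<phi> x"
  have bij: "bij_betw ?D (carrier G) (carrier G)"
    by (rule map_diff_fixed_point_free_bij[OF fpf fin subgroup_self]) auto
  then have surj: "y \<in> ?D ` carrier G" if "y \<in> carrier G" for y
    using that by (simp add: bij_betw_def)
  have D_closed: "?D x \<in> carrier G" if "x \<in> carrier G" for x
    using that by (simp add: map_diff_def)
  define \<psi> where "\<psi> y = inv (\<phi> (inv_into (carrier G) ?D y))" for y
  have \<psi>_D: "\<psi> (?D x) = inv (\<phi> x)" if "x \<in> carrier G" for x
    using that bij by (simp add: \<psi>_def bij_betw_def inv_into_f_f)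
  have \<psi>_hom: "\<psi> \<in> hom G G"
  proof (rule homI)
    fix y v assume y: "y \<in> carrier G" and v: "v \<in> carrier G"
    obtain x where x: "y = ?D x" "x \<in> carrier G"
      using surj[OF y] by (rule imageE)
    obtain z where z: "v = ?D z" "z \<in> carrier G"
      using surj[OF v] by (rule imageE)
    note xz = x z
    \<comment> \<open>Chosen so that \<open>y \<otimes> v = ?D w\<close>, which determines \<open>\<psi> (y \<otimes> v)\<close>.\<close>
    define w where "w = x \<otimes> inv (\<phi> x) \<otimes> z \<otimes> \<phi> x"
    have w: "w \<in> carrier G" using xz by (simp add: w_def)
    have "\<phi> w = \<phi> x \<otimes> inv (\<phi> (\<phi> x)) \<otimes> (\<phi> z \<otimes> \<phi> (\<phi> x))"
      using xz by (simp add: w_def m_assoc)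
    also have "\<dots> = \<phi> x \<otimes> inv (\<phi> (\<phi> x)) \<otimes> (\<phi> (\<phi> x) \<otimes> \<phi> z)"
      using comm xz by simp
    also have "\<dots> = \<phi> x \<otimes> \<phi> z"
      using xz by (simp add: word_simps)
    finally have \<phi>w: "\<phi> w = \<phi> z \<otimes> \<phi> x" using comm xz by simp
    have "y \<otimes> v = ?D w"
      using xz \<phi>w by (simp add: w_def[symmetric]) (simp add: w_def map_diff_def \<phi>w word_simps)
    then show "\<psi> (y \<otimes> v) = \<psi> y \<otimes> \<psi> v"
      using xz w \<phi>w by (simp add: \<psi>_D inv_mult_group)
  next
    fix y assume y: "y \<in> carrier G"
    obtain x where "y = ?D x" "x \<in> carrier G"
      using surj[OF y] by (rule imageE)
    then show "\<psi> y \<in> carrier G"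
      by (simp add: \<psi>_D)
  qed
  have left: "map_diff G id \<psi> (?D x) = x" if "x \<in> carrier G" for x
    using that by (simp add: map_diff_def[of G id \<psi>] \<psi>_D) (simp add: map_diff_def word_simps)
  have right: "map_diff G id \<psi> y \<in> carrier G" "?D (map_diff G id \<psi> y) = y"
    if y: "y \<in> carrier G" for y
  proof -
    obtain x where "y = ?D x" "x \<in> carrier G"
      using surj[OF y] by (rule imageE)
    then show "map_diff G id \<psi> y \<in> carrier G" "?D (map_diff G id \<psi> y) = y"
      by (simp_all add: left)
  qed
  have "inverse_maps_on (carrier G) ?D (map_diff G id \<psi>)"
    unfolding inverse_maps_on_def using D_closed left right by auto
  then show "quasi_invertible G \<phi>"
    unfolding quasi_invertible_def using fpf \<psi>_hom by blast
qed

end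

section \<open>Endomorphisms of a semidirect product\<close>

theorem theorem7p2:
  fixes G :: "('a, 'b) monoid_scheme" and K H :: "'a set"
    and \<theta> \<eta> \<phi> :: "'a \<Rightarrow> 'a"
  assumes "group G" and "finite (carrier G)"
    and "semidirect_product_of G K H"
    and "comm_group (G\<lparr>carrier := H\<rparr>)"
    and "fixed_point_free_endo (G\<lparr>carrier := H\<rparr>) \<theta>"
    and "nilpotent_endo (G\<lparr>carrier := K\<rparr>) \<eta>"
    and "\<And>h k. h \<in> H \<Longrightarrow> k \<in> K \<Longrightarrow> \<phi> (h \<otimes>\<^bsub>G\<^esub> k) = \<theta> h \<otimes>\<^bsub>G\<^esub> \<eta> k"
  shows "quasi_invertible G \<phi> \<longleftrightarrow>
    derived G (carrier G) = derived G K <#>\<^bsub>G\<^esub> commutator_subgroup G K H \<and>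
    derived G (carrier G) \<subseteq> kernel (G\<lparr>carrier := K\<rparr>) (G\<lparr>carrier := K\<rparr>) \<eta> \<and>
    commutator_subgroup G (\<eta> ` K) (\<theta> ` H) = {\<one>\<^bsub>G\<^esub>}"
proof -
  interpret group G by (rule assms(1))
  note \<phi>_eq = assms(7)
  have K: "K \<lhd> G" and subH: "subgroup H G" and G_eq: "carrier G = H <#>\<^bsub>G\<^esub> K"
    and HK: "H \<inter> K = {\<one>\<^bsub>G\<^esub>}"
    using assms(3) unfolding semidirect_product_of_def by auto
  note subK = normal_imp_subgroup[OF K]
  note KG = subgroup.subset[OF subK] and HG = subgroup.subset[OF subH]
  have H_comm: "h \<otimes>\<^bsub>G\<^esub> h' = h' \<otimes>\<^bsub>G\<^esub> h" if "h \<in> H" "h' \<in> H" for h h'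
    using comm_group.axioms(1)[OF assms(4)] comm_monoid.m_comm[of "G\<lparr>carrier := H\<rparr>"] that by simp
  have \<theta>: "\<theta> \<in> hom (G\<lparr>carrier := H\<rparr>) (G\<lparr>carrier := H\<rparr>)"
    and \<theta>_fpf: "\<And>h. \<lbrakk>h \<in> H; \<theta> h = h\<rbrakk> \<Longrightarrow> h = \<one>\<^bsub>G\<^esub>"
    using assms(5) unfolding fixed_point_free_endo_def by auto
  obtain n where \<eta>: "\<eta> \<in> hom (G\<lparr>carrier := K\<rparr>) (G\<lparr>carrier := K\<rparr>)"
    and \<eta>_nil: "\<And>k. k \<in> K \<Longrightarrow> (\<eta> ^^ n) k = \<one>\<^bsub>G\<^esub>"
    using assms(6) unfolding nilpotent_endo_def by auto
  have \<theta>_closed: "\<theta> h \<in> H" and \<theta>_mult: "\<theta> (h \<otimes>\<^bsub>G\<^esub> h') = \<theta> h \<otimes>\<^bsub>G\<^esub> \<theta> h'"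
    if "h \<in> H" "h' \<in> H" for h h'
    using \<theta> that by (auto simp: hom_def)
  have \<eta>_closed: "\<eta> k \<in> K" and \<eta>_mult: "\<eta> (k \<otimes>\<^bsub>G\<^esub> k') = \<eta> k \<otimes>\<^bsub>G\<^esub> \<eta> k'"
    if "k \<in> K" "k' \<in> K" for k k'
    using \<eta> that by (auto simp: hom_def)
  have one: "\<one>\<^bsub>G\<^esub> \<in> H" "\<one>\<^bsub>G\<^esub> \<in> K"
    using HK by auto
  have \<theta>_one: "\<theta> \<one>\<^bsub>G\<^esub> = \<one>\<^bsub>G\<^esub>"
    using \<theta>_closed[OF one(1) one(1)] \<theta>_mult[OF one(1) one(1)] HG l_cancel_one' by auto
  have \<eta>_one: "\<eta> \<one>\<^bsub>G\<^esub> = \<one>\<^bsub>G\<^esub>"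
    using \<eta>_closed[OF one(2) one(2)] \<eta>_mult[OF one(2) one(2)] KG l_cancel_one' by auto
  have \<phi>_H: "\<phi> h = \<theta> h" if "h \<in> H" for h
    using \<phi>_eq[OF that one(2)] that \<theta>_closed[OF that that] HG \<eta>_one by (auto simp: subset_iff)
  have \<phi>_K: "\<phi> k = \<eta> k" if "k \<in> K" for k
    using \<phi>_eq[OF one(1) that] that \<eta>_closed[OF that that] KG \<theta>_one by (auto simp: subset_iff)
  have der: "derived G (carrier G) = derived G K <#>\<^bsub>G\<^esub> commutator_subgroup G K H"
    by (rule derived_eq_derived_mult_commutator_subgroup[OF K subH G_eq H_comm])
  have der_K: "derived G (carrier G) \<subseteq> K"
  proof -
    have "derived G K \<subseteq> K"
      by (rule derived_incl[OF subset_refl subK])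
    moreover have "commutator_subgroup G K H \<subseteq> K"
    proof (rule commutator_subgroup_minimal[OF subK])
      fix k h assume kh: "k \<in> K" "h \<in> H"
      then have c: "k \<in> carrier G" "h \<in> carrier G" using KG HG by auto
      have "k \<otimes>\<^bsub>G\<^esub> (h \<otimes>\<^bsub>G\<^esub> inv\<^bsub>G\<^esub> k \<otimes>\<^bsub>G\<^esub> inv\<^bsub>G\<^esub> h) \<in> K"
        using kh c normal_invE(2)[OF K] subK by (simp add: subgroup.m_closed subgroup.m_inv_closed)
      then show "k \<otimes>\<^bsub>G\<^esub> h \<otimes>\<^bsub>G\<^esub> inv\<^bsub>G\<^esub> k \<otimes>\<^bsub>G\<^esub> inv\<^bsub>G\<^esub> h \<in> K"
        using c by (simp add: m_assoc)
    qed
    ultimately show ?thesis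
      unfolding der set_mult_def using subgroup.m_closed[OF subK] by blast
  qed
  have ker_iff: "derived G (carrier G) \<subseteq> kernel (G\<lparr>carrier := K\<rparr>) (G\<lparr>carrier := K\<rparr>) \<eta> \<longleftrightarrow>
      derived G (carrier G) \<subseteq> kernel G G \<phi>"
    using der_K \<phi>_K KG by (auto simp: kernel_def subset_iff)
  have img: "\<eta> ` K \<subseteq> carrier G" "\<theta> ` H \<subseteq> carrier G"
    using \<eta>_closed \<theta>_closed KG HG by blast+
  have "fixed_point_free_endo G \<phi>"
    if ker: "derived G (carrier G) \<subseteq> kernel (G\<lparr>carrier := K\<rparr>) (G\<lparr>carrier := K\<rparr>) \<eta>"
      and com: "commutator_subgroup G (\<eta> ` K) (\<theta> ` H) = {\<one>\<^bsub>G\<^esub>}"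
  proof -
    have \<theta>\<eta>_comm: "\<eta> k \<otimes>\<^bsub>G\<^esub> \<theta> h = \<theta> h \<otimes>\<^bsub>G\<^esub> \<eta> k" if "k \<in> K" "h \<in> H" for k h
      using com that commutator_subgroup_trivial_iff[OF img] by blast
    \<comment> \<open>\<open>h\<^sup>-\<^sup>1 k h = [h\<^sup>-\<^sup>1, k] k\<close> and \<open>\<eta>\<close> kills commutators.\<close>
    have \<eta>_conj: "inv\<^bsub>G\<^esub> h \<otimes>\<^bsub>G\<^esub> k \<otimes>\<^bsub>G\<^esub> h \<in> K" "\<eta> (inv\<^bsub>G\<^esub> h \<otimes>\<^bsub>G\<^esub> k \<otimes>\<^bsub>G\<^esub> h) = \<eta> k"
      if "k \<in> K" "h \<in> H" for k h
    proof -
      let ?c = "inv\<^bsub>G\<^esub> h \<otimes>\<^bsub>G\<^esub> k \<otimes>\<^bsub>G\<^esub> inv\<^bsub>G\<^esub> (inv\<^bsub>G\<^esub> h) \<otimes>\<^bsub>G\<^esub> inv\<^bsub>G\<^esub> k"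
      have c: "k \<in> carrier G" "h \<in> carrier G" using that KG HG by auto
      have "?c \<in> derived G (carrier G)"
        unfolding derived_def using c by (intro generate.incl) blast
      then have "?c \<in> K" "\<eta> ?c = \<one>\<^bsub>G\<^esub>"
        using ker by (auto simp: kernel_def)
      moreover have eq: "inv\<^bsub>G\<^esub> h \<otimes>\<^bsub>G\<^esub> k \<otimes>\<^bsub>G\<^esub> h = ?c \<otimes>\<^bsub>G\<^esub> k"
        using c by (simp add: word_simps)
      ultimately show "inv\<^bsub>G\<^esub> h \<otimes>\<^bsub>G\<^esub> k \<otimes>\<^bsub>G\<^esub> h \<in> K" "\<eta> (inv\<^bsub>G\<^esub> h \<otimes>\<^bsub>G\<^esub> k \<otimes>\<^bsub>G\<^esub> h) = \<eta> k"
        using that subgroup.m_closed[OF subK] \<eta>_mult[of ?c k] \<eta>_closed KG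
        by (auto simp: eq subset_iff simp del: inv_inv)
    qed
    have "\<phi> \<in> hom G G"
    proof (rule homI)
      fix x assume "x \<in> carrier G"
      then obtain h k where "h \<in> H" "k \<in> K" "x = h \<otimes>\<^bsub>G\<^esub> k"
        unfolding G_eq set_mult_def by blast
      then show "\<phi> x \<in> carrier G"
        using \<phi>_eq \<theta>_closed \<eta>_closed KG HG by (auto intro!: m_closed)
    next
      fix x y assume "x \<in> carrier G" "y \<in> carrier G"
      then obtain h k h' k' where x: "h \<in> H" "k \<in> K" "x = h \<otimes>\<^bsub>G\<^esub> k"
        and y: "h' \<in> H" "k' \<in> K" "y = h' \<otimes>\<^bsub>G\<^esub> k'"
        unfolding G_eq set_mult_def by blast
      let ?k = "inv\<^bsub>G\<^esub> h' \<otimes>\<^bsub>G\<^esub> k \<otimes>\<^bsub>G\<^esub> h'"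
      have c: "h \<in> carrier G" "k \<in> carrier G" "h' \<in> carrier G" "k' \<in> carrier G"
        and c': "\<theta> h \<in> carrier G" "\<eta> k \<in> carrier G" "\<theta> h' \<in> carrier G" "\<eta> k' \<in> carrier G"
        using x y KG HG \<theta>_closed \<eta>_closed by auto
      have "x \<otimes>\<^bsub>G\<^esub> y = (h \<otimes>\<^bsub>G\<^esub> h') \<otimes>\<^bsub>G\<^esub> (?k \<otimes>\<^bsub>G\<^esub> k')"
        using c x y by (simp add: word_simps)
      then have "\<phi> (x \<otimes>\<^bsub>G\<^esub> y) = \<theta> (h \<otimes>\<^bsub>G\<^esub> h') \<otimes>\<^bsub>G\<^esub> \<eta> (?k \<otimes>\<^bsub>G\<^esub> k')"
        using x y \<eta>_conj(1) subgroup.m_closed[OF subK] subgroup.m_closed[OF subH] \<phi>_eq by simp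
      also have "\<dots> = \<theta> h \<otimes>\<^bsub>G\<^esub> (\<theta> h' \<otimes>\<^bsub>G\<^esub> \<eta> k) \<otimes>\<^bsub>G\<^esub> \<eta> k'"
        using x y \<eta>_conj \<theta>_mult \<eta>_mult c' by (simp add: m_assoc)
      also have "\<dots> = \<theta> h \<otimes>\<^bsub>G\<^esub> (\<eta> k \<otimes>\<^bsub>G\<^esub> \<theta> h') \<otimes>\<^bsub>G\<^esub> \<eta> k'"
        using \<theta>\<eta>_comm x y by simp
      also have "\<dots> = \<phi> x \<otimes>\<^bsub>G\<^esub> \<phi> y"
        using x y \<phi>_eq c' by (simp add: m_assoc)
      finally show "\<phi> (x \<otimes>\<^bsub>G\<^esub> y) = \<phi> x \<otimes>\<^bsub>G\<^esub> \<phi> y" .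
    qed
    moreover have "x = \<one>\<^bsub>G\<^esub>" if xG: "x \<in> carrier G" and fixed: "\<phi> x = x" for x
    proof -
      obtain h k where x: "h \<in> H" "k \<in> K" "x = h \<otimes>\<^bsub>G\<^esub> k"
        using xG unfolding G_eq set_mult_def by blast
      then have c: "h \<in> carrier G" "k \<in> carrier G" "\<theta> h \<in> carrier G" "\<eta> k \<in> carrier G"
        using KG HG \<theta>_closed \<eta>_closed by auto
      have eq: "\<theta> h \<otimes>\<^bsub>G\<^esub> \<eta> k = h \<otimes>\<^bsub>G\<^esub> k"
        using fixed x \<phi>_eq by simp
      then have "inv\<^bsub>G\<^esub> h \<otimes>\<^bsub>G\<^esub> \<theta> h = k \<otimes>\<^bsub>G\<^esub> inv\<^bsub>G\<^esub> (\<eta> k)"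
        using c by (metis inv_closed inv_solve_left inv_solve_right m_assoc m_closed)
      moreover have "inv\<^bsub>G\<^esub> h \<otimes>\<^bsub>G\<^esub> \<theta> h \<in> H" "k \<otimes>\<^bsub>G\<^esub> inv\<^bsub>G\<^esub> (\<eta> k) \<in> K"
        using x \<theta>_closed \<eta>_closed subH subK
        by (auto intro!: subgroup.m_closed subgroup.m_inv_closed)
      ultimately have "inv\<^bsub>G\<^esub> h \<otimes>\<^bsub>G\<^esub> \<theta> h = \<one>\<^bsub>G\<^esub>"
        using HK by auto
      then have "\<theta> h = h"
        using c by (metis inv_closed inv_equality inv_inv)
      then have h: "h = \<one>\<^bsub>G\<^esub>" by (rule \<theta>_fpf[OF x(1)])
      then have "\<eta> k = k" using eq c \<theta>_one by simp
      then have "(\<eta> ^^ n) k = k" by (induction n) simp_all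
      then have "k = \<one>\<^bsub>G\<^esub>" using \<eta>_nil[OF x(2)] by simp
      then show ?thesis using h x(3) by simp
    qed
    ultimately show ?thesis
      unfolding fixed_point_free_endo_def by blast
  qed
  moreover have "fixed_point_free_endo G \<phi>" if "quasi_invertible G \<phi>"
    using that unfolding quasi_invertible_def by blast
  moreover have "quasi_invertible G \<phi> \<longleftrightarrow>
      derived G (carrier G) \<subseteq> kernel (G\<lparr>carrier := K\<rparr>) (G\<lparr>carrier := K\<rparr>) \<eta>"
    if "fixed_point_free_endo G \<phi>"
    using that quasi_invertible_iff_abelian_image[OF that assms(2)] derived_subset_kernel_iff ker_iff
    unfolding fixed_point_free_endo_def by blast
  moreover have "commutator_subgroup G (\<eta> ` K) (\<theta> ` H) = {\<one>\<^bsub>G\<^esub>}" if "quasi_invertible G \<phi>"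
  proof -
    have "fixed_point_free_endo G \<phi>"
      using that unfolding quasi_invertible_def by blast
    then have "\<forall>x\<in>carrier G. \<forall>y\<in>carrier G. \<phi> x \<otimes>\<^bsub>G\<^esub> \<phi> y = \<phi> y \<otimes>\<^bsub>G\<^esub> \<phi> x"
      using that quasi_invertible_iff_abelian_image assms(2) by blast
    then show ?thesis
      using KG HG \<phi>_K \<phi>_H by (auto simp: commutator_subgroup_trivial_iff[OF img] subset_iff) metis
  qed
  ultimately show ?thesis
    using der by blast
qed

end
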